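(* (1) If $A$ and $B$ are Borel separable subsets of $2^{\mathbb{N}}$ (that is, some Borel $S \subseteq 2^{\mathbb{N}}$ satisfies $A \subseteq S$ and $S \cap B = \emptyset$), then the minimum rank of a Borel set separating $A$ and $B$ is precisely $D(\mathrm{KW}_{A,B})$. (2) The Borel rank of a Borel set $B \subseteq 2^{\mathbb{N}}$ is precisely $D(\mathrm{KW}_{B,B^c})$, where $B^c = 2^{\mathbb{N}} \setminus B$.
   Context: $2^{\mathbb{N}}$ is the Cantor space of infinite binary strings $x = x_0x_1\cdots$ with its usual product topology. Borel rank. A set $S \subseteq 2^{\mathbb{N}}$ is $\boldsymbol{\Sigma}^0_0$, equivalently $\boldsymbol{\Pi}^0_0$, if it is clopen. For $1 \leq \alpha < \omega_1$, a set is $\boldsymbol{\Sigma}^0_\alpha$ (resp. $\boldsymbol{\Pi}^0_\alpha$) if it is a countable union (resp. intersection) of sets $S_n$, $n \in \mathbb{N}$, with each $S_n$ in $\boldsymbol{\Pi}^0_{\beta_n}$ (resp. $\boldsymbol{\Sigma}^0_{\beta_n}$) for some $\beta_n < \alpha$. The rank of a Borel set $B$ is the least $\alpha$ with $B \in \boldsymbol{\Sigma}^0_\alpha \cup \boldsymbol{\Pi}^0_\alpha$. Essential rank. For a well-founded tree $T$ and node $v$, set $\mathrm{rank}(v) = 0$ if the subtree rooted at $v$ is finite, and otherwise $\mathrm{rank}(v) = \sup\{\mathrm{rank}(w)+1 : w \text{ a child of } v\}$. The essential rank of $T$ is that of its root. Infinite communication protocols. Let $X = Y = 2^{\mathbb{N}}$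 and let $Z$ be a countable set. A protocol $P$ is a countable, well-founded (no infinite branch) rooted tree in which each internal node $v$ is labeled either by a function $a_v \colon X \to \mathbb{N}$ (Alice's node) or by a function $b_v \colon Y \to \mathbb{N}$ (Bob's node), these functions being arbitrary, and each leaf is labeled by an element of $Z$. Every edge is labeled with some natural number, and for each internal node $v$ and each $n$ in the range of $a_v$ (resp. $b_v$), exactly one edge from $v$ to one of its children is labeled $n$. The protocol computes a function $P \colon X \times Y \to Z$: on input $(x,y)$ start at the root; at an internal node $v$ follow the edge labeled $a_v(x)$ (if $v$ is Alice's) or $b_v(y)$ (if $v$ is Bob's); output the label of the leaf eventually reached. The cost of a protocol is the essential rank of its underlying tree. KW games. For $A,B \subseteq 2^{\mathbb{N}}$, a protocol $P$ with $Z = \mathbb{N}$ solves $\mathrm{KW}_{A,B}$ if for all $(x,y) \in A \times B$ the strings $x$ and $y$ differ at index $P(x,y)$. $D(\mathrm{KW}_{A,B})$ is the minimum cost of a protocol solving $\mathrm{KW}_{A,B}$. *)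

theory Defs
  imports "HOL-Analysis.Analysis"
begin

unbundle cardinal_syntax

text \<open>
  The countable ordinals, i.e. the ordinals below the first uncountable one.  In the library,
  \<open>cardSuc natLeq\<close> is a well-order whose order type is the least uncountable ordinal.
\<close>

typedef omega1 = "Field (cardSuc natLeq)"
proof -
  have "\<not> finite (Field (cardSuc natLeq))"
    using cardSuc_finite[OF natLeq_Card_order] by (simp add: Field_natLeq)
  then show ?thesis
    by (metis finite.emptyI ex_in_conv)
qed

lemma wo_cardSuc_natLeq: "Well_order (cardSuc natLeq)"
  using cardSuc_Card_order[OF natLeq_Card_order] card_order_on_well_order_on by blast

instantiation omega1 :: wellorder
begin

definition less_eq_omega1 :: "omega1 \<Rightarrow> omega1 \<Rightarrow> bool" where
  "\<alpha> \<le> \<beta> \<longleftrightarrow> (Rep_omega1 \<alpha>, Rep_omega1 \<beta>) \<in> cardSuc natLeq"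

definition less_omega1 :: "omega1 \<Rightarrow> omega1 \<Rightarrow> bool" where
  "\<alpha> < \<beta> \<longleftrightarrow> \<alpha> \<le> \<beta> \<and> \<not> \<beta> \<le> (\<alpha>::omega1)"

instance
proof
  let ?r = "cardSuc natLeq"
  have W: "refl_on (Field ?r) ?r" "trans ?r" "antisym ?r" "total_on (Field ?r) ?r" "wf (?r - Id)"
    using wo_cardSuc_natLeq unfolding order_on_defs by blast+
  fix x y z :: omega1
  show "x < y \<longleftrightarrow> x \<le> y \<and> \<not> y \<le> x" by (rule less_omega1_def)
  show "x \<le> x"
    unfolding less_eq_omega1_def by (rule refl_onD[OF W(1) Rep_omega1])
  show "x \<le> y \<Longrightarrow> y \<le> z \<Longrightarrow> x \<le> z"
    unfolding less_eq_omega1_def by (rule transD[OF W(2)])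
  show "x \<le> y \<Longrightarrow> y \<le> x \<Longrightarrow> x = y"
    unfolding less_eq_omega1_def Rep_omega1_inject[symmetric] by (rule antisymD[OF W(3)])
  show "x \<le> y \<or> y \<le> x"
    using W(4) Rep_omega1[of x] Rep_omega1[of y] refl_onD[OF W(1) Rep_omega1[of x]]
    unfolding less_eq_omega1_def total_on_def by (cases "Rep_omega1 x = Rep_omega1 y") auto
  fix P and a :: omega1
  assume IH: "\<And>x. (\<And>y. y < x \<Longrightarrow> P y) \<Longrightarrow> P (x::omega1)"
  have wf: "wf (inv_image (cardSuc natLeq - Id) Rep_omega1)"
    by (rule wf_inv_image[OF W(5)])
  show "P a"
    using wf
  proof (induction a rule: wf_induct_rule)
    case (less x)
    show ?case
    proof (rule IH)
      fix y assume "y < x"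
      then have "(y, x) \<in> inv_image (cardSuc natLeq - Id) Rep_omega1"
        unfolding less_omega1_def less_eq_omega1_def by auto
      then show "P y" by (rule less)
    qed
  qed
qed

end

lemma countable_iff_card_of: "countable A \<longleftrightarrow> |A| \<le>o |UNIV :: nat set|"
  unfolding countable_def card_of_ordLeq[symmetric] by auto

lemma countable_initial_segment_omega1: "countable {..\<alpha>::omega1}"
proof -
  let ?r = "cardSuc natLeq"
  have "|underS ?r (Rep_omega1 \<alpha>)| <o ?r"
    by (rule card_of_underS[OF cardSuc_Card_order[OF natLeq_Card_order] Rep_omega1])
  then have "|underS ?r (Rep_omega1 \<alpha>)| \<le>o natLeq"
    by (rule iffD1[OF cardSuc_ordLeq_ordLess[OF natLeq_Card_order card_of_Card_order]])
  then have "|underS ?r (Rep_omega1 \<alpha>)| \<le>o |UNIV :: nat set|"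
    by (rule ordLeq_ordIso_trans[OF _ ordIso_symmetric[OF card_of_nat]])
  then have "countable (underS ?r (Rep_omega1 \<alpha>))"
    by (rule iffD2[OF countable_iff_card_of])
  then have "countable (Rep_omega1 -` underS ?r (Rep_omega1 \<alpha>))"
    by (intro countable_image_inj_on[of Rep_omega1] countable_subset[OF image_vimage_subset])
       (auto simp: inj_on_def Rep_omega1_inject)
  moreover have "{..\<alpha>} \<subseteq> insert \<alpha> (Rep_omega1 -` underS ?r (Rep_omega1 \<alpha>))"
    by (auto simp: less_eq_omega1_def underS_def Rep_omega1_inject)
  ultimately show ?thesis
    by (rule countable_subset[OF _ countable_insert, rotated])
qed

lemma uncountable_omega1: "uncountable (UNIV :: omega1 set)"
proof
  let ?r = "cardSuc natLeq"
  assume "countable (UNIV :: omega1 set)"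
  then have "countable (range Rep_omega1)" by (rule countable_image)
  then have "countable (Field ?r)"
    by (metis type_definition.Rep_range[OF type_definition_omega1])
  then have "|Field ?r| \<le>o |UNIV :: nat set|"
    by (rule iffD1[OF countable_iff_card_of])
  then have "?r \<le>o natLeq"
    by (rule ordIso_ordLeq_trans[OF
          ordIso_symmetric[OF card_of_Field_ordIso[OF cardSuc_Card_order[OF natLeq_Card_order]]]
          ordLeq_ordIso_trans[OF _ card_of_nat]])
  then show False
    using cardSuc_greater[OF natLeq_Card_order] not_ordLess_ordLeq by blast
qed

lemma countable_bounded_omega1:
  assumes "countable A"
  obtains \<beta> :: omega1 where "\<And>\<alpha>. \<alpha> \<in> A \<Longrightarrow> \<alpha> < \<beta>"
proof -
  have "\<exists>\<beta>. \<forall>\<alpha>\<in>A. \<alpha> < \<beta>"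
  proof (rule ccontr)
    assume "\<not> ?thesis"
    then have "UNIV = (\<Union>\<alpha>\<in>A. {..\<alpha>})" by (force simp: not_less)
    moreover have "countable (\<Union>\<alpha>\<in>A. {..\<alpha>})"
      using assms countable_initial_segment_omega1 by (intro countable_UN) auto
    ultimately show False using uncountable_omega1 by simp
  qed
  then show thesis using that by blast
qed

instantiation omega1 :: "{conditionally_complete_linorder, zero}"
begin

definition Inf_omega1 :: "omega1 set \<Rightarrow> omega1" where
  "Inf A = (LEAST \<alpha>::omega1. \<alpha> \<in> A)"

definition Sup_omega1 :: "omega1 set \<Rightarrow> omega1" where
  "Sup A = (LEAST \<beta>::omega1. \<forall>\<alpha>\<in>A. \<alpha> \<le> \<beta>)"

definition inf_omega1 :: "omega1 \<Rightarrow> omega1 \<Rightarrow> omega1" where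
  "inf \<alpha> \<beta> = min \<alpha> (\<beta>::omega1)"

definition sup_omega1 :: "omega1 \<Rightarrow> omega1 \<Rightarrow> omega1" where
  "sup \<alpha> \<beta> = max \<alpha> (\<beta>::omega1)"

definition zero_omega1 :: omega1 where
  "0 = (LEAST \<alpha>::omega1. True)"

instance
proof
  fix x y z :: omega1 and A :: "omega1 set"
  show "inf x y \<le> x" "inf x y \<le> y" "x \<le> y \<Longrightarrow> x \<le> z \<Longrightarrow> x \<le> inf y z"
    unfolding inf_omega1_def by (rule min.cobounded1 min.cobounded2 min.boundedI; assumption?)+
  show "x \<le> sup x y" "y \<le> sup x y" "y \<le> x \<Longrightarrow> z \<le> x \<Longrightarrow> sup y z \<le> x"
    unfolding sup_omega1_def by (rule max.cobounded1 max.cobounded2 max.boundedI; assumption?)+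
  show "x \<in> A \<Longrightarrow> bdd_below A \<Longrightarrow> Inf A \<le> x"
    unfolding Inf_omega1_def by (rule Least_le)
  show "z \<le> Inf A" if "A \<noteq> {}" and z: "\<And>x. x \<in> A \<Longrightarrow> z \<le> x"
  proof -
    from \<open>A \<noteq> {}\<close> obtain a where "a \<in> A" by blast
    then have "Inf A \<in> A" unfolding Inf_omega1_def by (rule LeastI)
    then show ?thesis by (rule z)
  qed
  show "x \<le> Sup A" if x: "x \<in> A" and "bdd_above A"
  proof -
    from \<open>bdd_above A\<close> obtain b where "\<forall>\<alpha>\<in>A. \<alpha> \<le> b" unfolding bdd_above_def by blast
    then have "\<forall>\<alpha>\<in>A. \<alpha> \<le> Sup A" unfolding Sup_omega1_def by (rule LeastI)
    with x show ?thesis by blast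
  qed
  show "A \<noteq> {} \<Longrightarrow> (\<And>x. x \<in> A \<Longrightarrow> x \<le> z) \<Longrightarrow> Sup A \<le> z"
    unfolding Sup_omega1_def by (rule Least_le) blast
qed

end

unbundle no cardinal_syntax

definition succ_omega1 :: "omega1 \<Rightarrow> omega1" where
  "succ_omega1 \<alpha> = (LEAST \<beta>. \<alpha> < \<beta>)"

text \<open>
  On functions, \<open>open\<close>, \<open>closed\<close> and \<open>borel\<close> refer to the product topology; \<open>bool\<close> is discrete.
\<close>

type_synonym cantor = "nat \<Rightarrow> bool"

inductive Sigma0 :: "omega1 \<Rightarrow> cantor set \<Rightarrow> bool"
  and Pi0 :: "omega1 \<Rightarrow> cantor set \<Rightarrow> bool" where
  Sigma0_clopen: "open S \<Longrightarrow> closed S \<Longrightarrow> Sigma0 0 S"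
| Pi0_clopen: "open S \<Longrightarrow> closed S \<Longrightarrow> Pi0 0 S"
| Sigma0_Union: "0 < \<alpha> \<Longrightarrow> (\<And>n::nat. \<beta> n < \<alpha>) \<Longrightarrow> (\<And>n. Pi0 (\<beta> n) (S n)) \<Longrightarrow> Sigma0 \<alpha> (\<Union>n. S n)"
| Pi0_Inter: "0 < \<alpha> \<Longrightarrow> (\<And>n::nat. \<beta> n < \<alpha>) \<Longrightarrow> (\<And>n. Sigma0 (\<beta> n) (S n)) \<Longrightarrow> Pi0 \<alpha> (\<Inter>n. S n)"

definition borel_rank :: "cantor set \<Rightarrow> omega1" where
  "borel_rank B = (LEAST \<alpha>. Sigma0 \<alpha> B \<or> Pi0 \<alpha> B)"

definition separates :: "'a set \<Rightarrow> 'a set \<Rightarrow> 'a set \<Rightarrow> bool" where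
  "separates S A B \<longleftrightarrow> A \<subseteq> S \<and> S \<inter> B = {}"

definition separation_rank :: "cantor set \<Rightarrow> cantor set \<Rightarrow> omega1" where
  "separation_rank A B = (LEAST \<alpha>. \<exists>S\<in>sets borel. separates S A B \<and> borel_rank S = \<alpha>)"

text \<open>
  A countable rooted tree is represented by a prefix-closed set of finite sequences of natural
  numbers: the root is \<open>[]\<close> and the children of \<open>v\<close> are the nodes \<open>v @ [n]\<close>.  The number \<open>n\<close>
  merely distinguishes siblings; it is not the edge label of a protocol.
\<close>

definition children :: "nat list set \<Rightarrow> nat list \<Rightarrow> nat list set" where
  "children T v = {w \<in> T. \<exists>n. w = v @ [n]}"

definition subtree :: "nat list set \<Rightarrow> nat list \<Rightarrow> nat list set" where
  "subtree T v = {w \<in> T. \<exists>u. w = v @ u}"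

definition wf_tree :: "nat list set \<Rightarrow> bool" where
  "wf_tree T \<longleftrightarrow> [] \<in> T \<and> (\<forall>v n. v @ [n] \<in> T \<longrightarrow> v \<in> T)
     \<and> \<not> (\<exists>f :: nat \<Rightarrow> nat. \<forall>k. map f [0..<k] \<in> T)"

definition child_rel :: "nat list set \<Rightarrow> (nat list \<times> nat list) set" where
  "child_rel T = {(w, v). v \<in> T \<and> w \<in> children T v}"

definition node_rank :: "nat list set \<Rightarrow> nat list \<Rightarrow> omega1" where
  "node_rank T = wfrec (child_rel T) (\<lambda>rank v.
     if finite (subtree T v) then 0 else (SUP w\<in>children T v. succ_omega1 (rank w)))"

definition essential_rank :: "nat list set \<Rightarrow> omega1" where
  "essential_rank T = node_rank T []"

lemma wf_tree_prefix:
  assumes "wf_tree T" "v @ u \<in> T"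
  shows "v \<in> T"
  using assms(2)
proof (induction u rule: rev_induct)
  case (snoc n u)
  then show ?case using assms(1) unfolding wf_tree_def by (metis append_assoc)
qed simp

lemma wf_child_rel:
  assumes T: "wf_tree T"
  shows "wf (child_rel T)"
  unfolding wf_iff_no_infinite_down_chain
proof
  assume "\<exists>g. \<forall>i. (g (Suc i), g i) \<in> child_rel T"
  then obtain g where g: "\<And>i. (g (Suc i), g i) \<in> child_rel T" by blast
  then have "\<forall>i. \<exists>n. g (Suc i) = g i @ [n]" and gT: "\<And>i. g i \<in> T"
    by (auto simp: child_rel_def children_def)
  then obtain h where h: "\<And>i. g (Suc i) = g i @ [h i]" by metis
  define m where "m = length (g 0)"
  define f where "f k = (if k < m then g 0 ! k else h (k - m))" for k
  have g0: "map f [0..<m] = g 0"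
    by (rule nth_equalityI) (auto simp: m_def f_def)
  have gi: "g i = map f [0..<m + i]" for i
  proof (induction i)
    case (Suc i)
    have "f (m + i) = h i" by (simp add: f_def)
    then show ?case using Suc h[of i] by simp
  qed (simp add: g0)
  have "map f [0..<k] \<in> T" for k
  proof (rule wf_tree_prefix[OF T])
    have "[0..<m + k] = [0..<k] @ [k..<m + k]"
      using upt_add_eq_append[of 0 k m] by (simp add: add.commute)
    then have "map f [0..<k] @ map f [k..<m + k] = map f [0..<m + k]"
      by simp
    then show "map f [0..<k] @ map f [k..<m + k] \<in> T"
      using gi[of k] gT[of k] by simp
  qed
  then show False using T unfolding wf_tree_def by blast
qed

lemma node_rank_unfold:
  assumes "wf_tree T" "v \<in> T"
  shows "node_rank T v =
    (if finite (subtree T v) then 0 else (SUP w\<in>children T v. succ_omega1 (node_rank T w)))"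
  unfolding node_rank_def
  by (subst wfrec[OF wf_child_rel[OF assms(1)]])
     (auto simp: cut_def child_rel_def assms(2) intro!: SUP_cong)

datatype 'z node_label = Alice "cantor \<Rightarrow> nat" | Bob "cantor \<Rightarrow> nat" | Leaf 'z

text \<open>
  \<open>elabel P w\<close> is the label of the edge from the parent of \<open>w\<close> to \<open>w\<close>; the value \<open>elabel P []\<close> and
  the labels of sequences outside \<open>nodes P\<close> are irrelevant.  In a protocol, Alice's and Bob's nodes
  have at least one child because the range of a function on the Cantor space is nonempty, so they
  are exactly the internal nodes.  Children whose edge label is never used are allowed.
\<close>

record 'z proto =
  nodes :: "nat list set"
  nlabel :: "nat list \<Rightarrow> 'z node_label"
  elabel :: "nat list \<Rightarrow> nat"

definition protocol :: "'z::countable proto \<Rightarrow> bool" where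
  "protocol P \<longleftrightarrow> wf_tree (nodes P) \<and>
     (\<forall>v\<in>nodes P. case nlabel P v of
        Alice a \<Rightarrow> \<forall>n\<in>range a. \<exists>!w. w \<in> children (nodes P) v \<and> elabel P w = n
      | Bob b \<Rightarrow> \<forall>n\<in>range b. \<exists>!w. w \<in> children (nodes P) v \<and> elabel P w = n
      | Leaf z \<Rightarrow> children (nodes P) v = {})"

inductive visits :: "'z proto \<Rightarrow> cantor \<Rightarrow> cantor \<Rightarrow> nat list \<Rightarrow> bool" for P x y where
  visits_root: "visits P x y []"
| visits_Alice: "visits P x y v \<Longrightarrow> nlabel P v = Alice a \<Longrightarrow> w \<in> children (nodes P) v \<Longrightarrow>
    elabel P w = a x \<Longrightarrow> visits P x y w"
| visits_Bob: "visits P x y v \<Longrightarrow> nlabel P v = Bob b \<Longrightarrow> w \<in> children (nodes P) v \<Longrightarrow>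
    elabel P w = b y \<Longrightarrow> visits P x y w"

definition run :: "'z proto \<Rightarrow> cantor \<Rightarrow> cantor \<Rightarrow> 'z" where
  "run P x y = (THE z. \<exists>v. visits P x y v \<and> nlabel P v = Leaf z)"

definition cost :: "'z proto \<Rightarrow> omega1" where
  "cost P = essential_rank (nodes P)"

lemma visits_nodes:
  assumes "protocol P" "visits P x y v"
  shows "v \<in> nodes P"
  using assms(2)
  by (induction rule: visits.induct) (use assms(1) in \<open>auto simp: protocol_def wf_tree_def children_def\<close>)

lemma visits_leaf_exists:
  assumes P: "protocol P"
  shows "visits P x y v \<Longrightarrow> \<exists>u z. visits P x y u \<and> nlabel P u = Leaf z"
proof -
  have "wf (child_rel (nodes P))" using P wf_child_rel by (auto simp: protocol_def)
  then show "visits P x y v \<Longrightarrow> \<exists>u z. visits P x y u \<and> nlabel P u = Leaf z"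
  proof (induction v rule: wf_induct_rule)
    case (less v)
    have v: "v \<in> nodes P" using visits_nodes[OF P less.prems] .
    show ?case
    proof (cases "nlabel P v")
      case (Alice a)
      then obtain w where w: "w \<in> children (nodes P) v" "elabel P w = a x"
        using P v unfolding protocol_def by fastforce
      show ?thesis
        using less.IH[of w] visits_Alice[OF less.prems Alice w] v w by (simp add: child_rel_def)
    next
      case (Bob b)
      then obtain w where w: "w \<in> children (nodes P) v" "elabel P w = b y"
        using P v unfolding protocol_def by fastforce
      show ?thesis
        using less.IH[of w] visits_Bob[OF less.prems Bob w] v w by (simp add: child_rel_def)
    next
      case (Leaf z)
      then show ?thesis using less.prems by blast
    qed
  qed
qed

lemma edge_unique:
  assumes P: "protocol P" and v: "v \<in> nodes P" and l: "nlabel P v = Alice a \<or> nlabel P v = Bob a"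
    and w: "w \<in> children (nodes P) v" "elabel P w = a x"
    and w': "w' \<in> children (nodes P) v" "elabel P w' = a x"
  shows "w = w'"
proof -
  have "\<forall>n\<in>range a. \<exists>!w. w \<in> children (nodes P) v \<and> elabel P w = n"
    using P v l unfolding protocol_def by (elim conjE disjE) (drule (1) bspec, simp only: node_label.case)+
  then have "\<exists>!w. w \<in> children (nodes P) v \<and> elabel P w = a x" by blast
  then show ?thesis using w w' by blast
qed

lemma visits_same_length:
  assumes P: "protocol P" and "visits P x y v" "visits P x y w" "length v = length w"
  shows "v = w"
  using assms(2-)
proof (induction arbitrary: w rule: visits.induct)
  case visits_root
  then show ?case by simp
next
  case (visits_Alice v a v')
  have len: "length w = Suc (length v)"
    using visits_Alice.hyps visits_Alice.prems by (auto simp: children_def)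
  have same: "u = v" if "visits P x y u" "w \<in> children (nodes P) u" for u
    using visits_Alice.IH[OF that(1)] that(2) len by (auto simp: children_def)
  have "\<exists>u. visits P x y u \<and> w \<in> children (nodes P) u \<and>
      (\<exists>a. nlabel P u = Alice a \<and> elabel P w = a x \<or> nlabel P u = Bob a \<and> elabel P w = a y)"
    using visits_Alice.prems(1) by (cases rule: visits.cases) (use len in auto)
  then have "w \<in> children (nodes P) v" "elabel P w = a x"
    using same visits_Alice.hyps(2) by auto
  then show ?case
    using edge_unique[OF P visits_nodes[OF P visits_Alice.hyps(1)]] visits_Alice.hyps by metis
next
  case (visits_Bob v b v')
  have len: "length w = Suc (length v)"
    using visits_Bob.hyps visits_Bob.prems by (auto simp: children_def)
  have same: "u = v" if "visits P x y u" "w \<in> children (nodes P) u" for u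
    using visits_Bob.IH[OF that(1)] that(2) len by (auto simp: children_def)
  have "\<exists>u. visits P x y u \<and> w \<in> children (nodes P) u \<and>
      (\<exists>a. nlabel P u = Alice a \<and> elabel P w = a x \<or> nlabel P u = Bob a \<and> elabel P w = a y)"
    using visits_Bob.prems(1) by (cases rule: visits.cases) (use len in auto)
  then have "w \<in> children (nodes P) v" "elabel P w = b y"
    using same visits_Bob.hyps(2) by auto
  then show ?case
    using edge_unique[OF P visits_nodes[OF P visits_Bob.hyps(1)]] visits_Bob.hyps by metis
qed

lemma visits_prefix:
  assumes "visits P x y v" "k < length v"
  shows "visits P x y (take k v) \<and> (\<nexists>z. nlabel P (take k v) = Leaf z)"
  using assms
proof (induction rule: visits.induct)
  case (visits_Alice v a w)
  then show ?case by (cases "k < length v") (auto simp: children_def)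
next
  case (visits_Bob v b w)
  then show ?case by (cases "k < length v") (auto simp: children_def)
qed simp

lemma visits_leaf_unique:
  assumes P: "protocol P"
    and v: "visits P x y v" "nlabel P v = Leaf z"
    and w: "visits P x y w" "nlabel P w = Leaf z'"
  shows "v = w"
proof (rule visits_same_length[OF P v(1) w(1)])
  have aux: "\<not> length u < length u'"
    if "visits P x y u" "nlabel P u = Leaf c" "visits P x y u'" for u u' c
  proof
    assume less: "length u < length u'"
    then have "take (length u) u' = u"
      using visits_prefix[OF that(3) less] visits_same_length[OF P _ that(1)] by simp
    then show False using visits_prefix[OF that(3) less] that(2) by simp
  qed
  show "length v = length w"
    using aux[OF v w(1)] aux[OF w v(1)] by simp
qed

lemma run_eqI:
  assumes "protocol P" "visits P x y v" "nlabel P v = Leaf z"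
  shows "run P x y = z"
  unfolding run_def using assms visits_leaf_unique[OF assms(1)]
  by (intro the_equality) (blast, metis node_label.inject(3))

definition solves_KW :: "nat proto \<Rightarrow> cantor set \<Rightarrow> cantor set \<Rightarrow> bool" where
  "solves_KW P A B \<longleftrightarrow> protocol P \<and> (\<forall>x\<in>A. \<forall>y\<in>B. x (run P x y) \<noteq> y (run P x y))"

definition D_KW :: "cantor set \<Rightarrow> cantor set \<Rightarrow> omega1" where
  "D_KW A B = (LEAST \<alpha>. \<exists>P. solves_KW P A B \<and> cost P = \<alpha>)"

end

theory Submission
  imports Defs
begin

text \<open>
  A protocol and a Borel code of a separating set are two readings of the same tree: a node where
  Alice speaks corresponds to a countable union, a node where Bob speaks to a countable
  intersection, and a leaf with label \<open>i\<close> to a set determined by the \<open>i\<close>-th coordinate.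

  From a protocol to a separator, one follows the protocol to a node \<open>v\<close>.  If \<open>v\<close> belongs to
  Alice, her message \<open>n\<close> splits \<open>A\<close> into countably many pieces \<open>A\<^sub>n\<close>, the \<open>n\<close>-th child
  separates \<open>A\<^sub>n\<close> from \<open>B\<close>, and the union of these separators separates \<open>A\<close> from \<open>B\<close>.
  Dually, Bob's messages split \<open>B\<close> and the separators are intersected.  Below a node of rank \<open>0\<close>
  the subtree is finite, so only finitely many unions and intersections of clopen sets occur
  (\<open>finite_subtree_clopen_separator\<close>).  Above, the rank strictly decreases from a node to its
  children, so a node of rank \<open>\<alpha>\<close> yields a separator of class \<open>\<Sigma>\<^sub>\<alpha>\<close> or \<open>\<Pi>\<^sub>\<alpha>\<close>
  (\<open>separator_of_node\<close>).  The speakers need not alternate, yet two consecutive nodes of Alice cost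
  nothing in this count: a countable union of sets that are themselves countable unions is a
  single countable union (\<open>Sigma0_countable_Union\<close>).

  From a separator to a protocol, let \<open>S = (\<Union>n. S\<^sub>n)\<close> with \<open>S\<^sub>n\<close> in \<open>\<Pi>\<^sub>\<beta>\<close>, \<open>\<beta> < \<alpha>\<close>.
  Alice announces the least \<open>n\<close> with \<open>x \<in> S\<^sub>n\<close>; since \<open>y\<close> lies outside every \<open>S\<^sub>n\<close>, the players can go
  on with a protocol for \<open>S\<^sub>n\<close> against its complement.  For an intersection Bob announces some \<open>S\<^sub>n\<close>
  that excludes \<open>y\<close>.  For a clopen \<open>S\<close>, compactness of the Cantor space bounds the coordinates on
  which membership depends, so that Alice can send all of them and Bob can answer with a
  difference: a finite tree (\<open>solves_KW_hierarchy\<close>).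

  Neither translation increases the rank, so the two minima agree.  The statement on the Borel
  rank of \<open>B\<close> is the case of the pair \<open>B\<close>, \<open>- B\<close>, whose only separator is \<open>B\<close> itself.
\<close>

section \<open>Countable ordinals\<close>

lemma zero_le_omega1 [simp]: "0 \<le> (\<alpha>::omega1)"
  unfolding zero_omega1_def by (rule Least_le) simp

lemma less_imp_pos_omega1: "\<beta> < \<alpha> \<Longrightarrow> 0 < (\<alpha>::omega1)"
  by (rule le_less_trans[OF zero_le_omega1])

lemma less_succ_omega1: "\<alpha> < succ_omega1 \<alpha>"
proof -
  obtain \<beta> where "\<alpha> < \<beta>" by (rule countable_bounded_omega1[of "{\<alpha>}"]) auto
  then show ?thesis unfolding succ_omega1_def by (rule LeastI)
qed

lemma succ_omega1_le: "\<alpha> < \<beta> \<Longrightarrow> succ_omega1 \<alpha> \<le> \<beta>"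
  unfolding succ_omega1_def by (rule Least_le)

lemma countable_bdd_above_omega1: "countable (A :: omega1 set) \<Longrightarrow> bdd_above A"
  by (rule countable_bounded_omega1[of A]) (auto simp: bdd_above_def intro: less_imp_le)

section \<open>The Borel hierarchy\<close>

lemma Sigma0_Pi0_Compl: "(Sigma0 \<alpha> S \<longrightarrow> Pi0 \<alpha> (- S)) \<and> (Pi0 \<alpha> S \<longrightarrow> Sigma0 \<alpha> (- S))"
proof -
  have "Sigma0 \<alpha> S \<Longrightarrow> Pi0 \<alpha> (- S)" "Pi0 \<alpha> S \<Longrightarrow> Sigma0 \<alpha> (- S)" for \<alpha> S
    by (induction rule: Sigma0_Pi0.inducts)
       (auto intro: Sigma0_Pi0.intros simp: open_Compl closed_Compl Compl_UN Compl_INT)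
  then show ?thesis by blast
qed

lemma Sigma0_Compl_iff [simp]: "Sigma0 \<alpha> (- S) \<longleftrightarrow> Pi0 \<alpha> S"
  and Pi0_Compl_iff [simp]: "Pi0 \<alpha> (- S) \<longleftrightarrow> Sigma0 \<alpha> S"
  using Sigma0_Pi0_Compl[of \<alpha> S] Sigma0_Pi0_Compl[of \<alpha> "- S"]
  unfolding double_compl by blast+

lemma Sigma0_Pi0_borel: "Sigma0 \<alpha> S \<Longrightarrow> S \<in> sets borel" "Pi0 \<alpha> S \<Longrightarrow> S \<in> sets borel"
  by (induction rule: Sigma0_Pi0.inducts) auto

text \<open>
  A clopen set of class \<open>\<Sigma>\<^sub>0\<close> is no union by definition, but it is the constant union of itself,
  viewed as a set of class \<open>\<Pi>\<^sub>0\<close>.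
\<close>

lemma Sigma0_imp_countable_Union:
  assumes "Sigma0 \<beta> S" "\<beta> < \<alpha>"
  obtains \<gamma> T where "\<And>n::nat. \<gamma> n < \<alpha> \<and> Pi0 (\<gamma> n) (T n)" "S = (\<Union>n. T n)"
  using assms(1)
proof cases
  case Sigma0_clopen
  then show ?thesis using that[of "\<lambda>_. 0" "\<lambda>_. S"] assms(2) by (auto intro: Pi0_clopen)
next
  case (Sigma0_Union \<gamma> T)
  then show ?thesis using that[of \<gamma> T] assms(2) by (blast intro: less_trans)
qed

text \<open>
  The sets \<open>S n\<close> may be on either side of the hierarchy.  Those in \<open>\<Sigma>\<close> are written as unions of sets in
  \<open>\<Pi>\<close> of smaller rank, and the resulting double union is reindexed by a pairing function; hence
  taking the union of \<open>\<Sigma>\<close> sets does not raise the rank beyond \<open>\<alpha>\<close>.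
\<close>

lemma Sigma0_countable_Union:
  fixes \<beta> :: "nat \<Rightarrow> omega1"
  assumes "\<And>n. \<beta> n < \<alpha>" "\<And>n. Sigma0 (\<beta> n) (S n) \<or> Pi0 (\<beta> n) (S n)"
  shows "Sigma0 \<alpha> (\<Union>n. S n)"
proof -
  have "\<exists>\<gamma> T. (\<forall>k::nat. \<gamma> k < \<alpha> \<and> Pi0 (\<gamma> k) (T k)) \<and> S n = (\<Union>k. T k)" for n
    using assms(2)[of n]
  proof
    assume "Sigma0 (\<beta> n) (S n)"
    then show ?thesis using Sigma0_imp_countable_Union[OF _ assms(1)] by metis
  next
    assume "Pi0 (\<beta> n) (S n)"
    then show ?thesis
      using assms(1)[of n] by (intro exI[of _ "\<lambda>_. \<beta> n"] exI[of _ "\<lambda>_. S n"]) auto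
  qed
  then obtain \<gamma> T where T: "\<And>n k. \<gamma> n k < \<alpha> \<and> Pi0 (\<gamma> n k) (T n k)"
      and S: "\<And>n. S n = (\<Union>k::nat. T n k)"
    by metis
  have "Sigma0 \<alpha> (\<Union>i. (\<lambda>(n, k). T n k) (prod_decode i))"
    using T less_imp_pos_omega1[OF assms(1)]
    by (intro Sigma0_Union[where \<beta> = "\<lambda>i. (\<lambda>(n, k). \<gamma> n k) (prod_decode i)"])
       (auto simp: split_beta)
  moreover have "(\<Union>i. (\<lambda>(n, k). T n k) (prod_decode i)) = (\<Union>n. S n)"
  proof safe
    fix x n assume "x \<in> S n"
    then obtain k where "x \<in> T n k" using S by blast
    then show "x \<in> (\<Union>i. (\<lambda>(n, k). T n k) (prod_decode i))"
      by (intro UN_I[of "prod_encode (n, k)"]) auto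
  qed (auto simp: S split: prod.splits)
  ultimately show ?thesis by simp
qed

lemma clopen_coordinate: "open {x::cantor. x i = c}" "closed {x::cantor. x i = c}"
proof -
  have o: "open {x::cantor. x i = c}" for c
    using open_vimage[of "{c}" "\<lambda>x::cantor. x i"]
    by (simp add: vimage_def open_discrete)
  show "open {x::cantor. x i = c}" by (rule o)
  have "- {x::cantor. x i = c} = {x. x i = (\<not> c)}" by auto
  then show "closed {x::cantor. x i = c}" using o by (simp add: closed_def)
qed

definition cylinder :: "cantor \<Rightarrow> nat \<Rightarrow> cantor set" where
  "cylinder x m = {y. \<forall>i<m. y i = x i}"

lemma clopen_cylinder: "open (cylinder x m)" "closed (cylinder x m)"
proof -
  have "cylinder x m = (\<Inter>i\<in>{..<m}. {y. y i = x i})" by (auto simp: cylinder_def)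
  then show "open (cylinder x m)" "closed (cylinder x m)"
    by (auto intro!: open_INT closed_INT clopen_coordinate)
qed

lemma open_contains_cylinder:
  assumes "open S" "x \<in> S"
  obtains m where "cylinder x m \<subseteq> S"
proof -
  have "openin (product_topology (\<lambda>i. euclidean) UNIV) S"
    using assms(1) by (simp add: open_fun_def)
  from product_topology_open_contains_basis[OF this assms(2)]
  obtain X where X: "x \<in> Pi\<^sub>E UNIV X" "finite {i. X i \<noteq> UNIV}" "Pi\<^sub>E UNIV X \<subseteq> S"
    by auto
  obtain m where m: "\<And>i. X i \<noteq> UNIV \<Longrightarrow> i < m"
    using X(2) finite_nat_set_iff_bounded by auto
  have "cylinder x m \<subseteq> Pi\<^sub>E UNIV X"
    using m X(1) by (fastforce simp: cylinder_def PiE_iff)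
  then have "cylinder x m \<subseteq> S" using X(3) by (rule subset_trans)
  then show ?thesis by (rule that)
qed

lemma countable_cylinders: "countable {cylinder x m | x m. True}"
proof -
  have "{cylinder x m | x m. True} \<subseteq> range (\<lambda>l. {y. \<forall>i<length l. y i = l ! i})"
  proof safe
    fix x m
    show "cylinder x m \<in> range (\<lambda>l. {y. \<forall>i<length l. y i = l ! i})"
      by (rule image_eqI[of _ _ "map x [0..<m]"]) (auto simp: cylinder_def)
  qed
  then show ?thesis by (rule countable_subset) simp
qed

text \<open>
  Cylinders are clopen, there are countably many of them, and they form a base of the topology.
\<close>

lemma open_imp_Sigma0:
  assumes S: "open S" and "0 < \<alpha>"
  shows "Sigma0 \<alpha> S"
proof -
  define F where "F = insert {} {cylinder x m | x m. cylinder x m \<subseteq> S}"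
  have "countable F"
    unfolding F_def by (intro countable_insert countable_subset[OF _ countable_cylinders]) auto
  moreover have "F \<noteq> {}" by (simp add: F_def)
  ultimately obtain C :: "nat \<Rightarrow> cantor set" where C: "range C = F"
    using range_from_nat_into by metis
  have "open (C n) \<and> closed (C n)" for n
  proof -
    have "C n \<in> F" using C by blast
    then show ?thesis unfolding F_def by (auto intro: clopen_cylinder)
  qed
  then have "Sigma0 \<alpha> (\<Union>n. C n)"
    using \<open>0 < \<alpha>\<close> by (intro Sigma0_Union[where \<beta> = "\<lambda>_. 0"]) (auto intro: Pi0_clopen)
  moreover have "\<Union>F = S"
  proof
    show "S \<subseteq> \<Union>F"
    proof
      fix x assume "x \<in> S"
      then obtain m where "cylinder x m \<subseteq> S" by (rule open_contains_cylinder[OF S])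
      then show "x \<in> \<Union>F" unfolding F_def by (intro UnionI[of "cylinder x m"]) (auto simp: cylinder_def)
    qed
    show "\<Union>F \<subseteq> S" unfolding F_def by blast
  qed
  ultimately show ?thesis by (simp only: C)
qed

text \<open>
  Without this, the least rank of a Borel set would be the least element of an empty set.  The ranks
  of countably many sets have a strict upper bound below the first uncountable ordinal, so the
  hierarchy is closed under countable unions; complements exchange its two sides.
\<close>

lemma borel_in_hierarchy:
  assumes "S \<in> sets borel"
  shows "\<exists>\<alpha>. Sigma0 \<alpha> S \<or> Pi0 \<alpha> S"
proof -
  have "S \<in> sigma_sets UNIV {S. open S}" using assms by (simp add: borel_def)
  then show ?thesis
  proof induction
    case (Basic S)
    then show ?case
      using open_imp_Sigma0[of S "succ_omega1 0"] less_succ_omega1 by auto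
  next
    case Empty
    then show ?case by (blast intro: Sigma0_clopen)
  next
    case (Compl S)
    then show ?case by (metis Compl_eq_Diff_UNIV Sigma0_Compl_iff Pi0_Compl_iff)
  next
    case (Union S)
    then obtain \<beta> where \<beta>: "\<And>n. Sigma0 (\<beta> n) (S n) \<or> Pi0 (\<beta> n) (S n)" by metis
    obtain \<alpha> where "\<And>\<gamma>. \<gamma> \<in> range \<beta> \<Longrightarrow> \<gamma> < \<alpha>"
      by (rule countable_bounded_omega1[of "range \<beta>"]) auto
    then have "Sigma0 \<alpha> (\<Union>n. S n)" by (intro Sigma0_countable_Union[OF _ \<beta>]) auto
    then show ?case by blast
  qed
qed

lemma borel_rank_in_hierarchy:
  "S \<in> sets borel \<Longrightarrow> Sigma0 (borel_rank S) S \<or> Pi0 (borel_rank S) S"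
  unfolding borel_rank_def by (rule LeastI_ex[OF borel_in_hierarchy])

lemma compact_cantor: "compact (UNIV :: cantor set)"
proof -
  have compact_bool: "compact_space (euclidean :: bool topology)"
    by (simp add: compact_space_def finite_imp_compact)
  have "compact_space (product_topology (\<lambda>_::nat. euclidean :: bool topology) UNIV)"
    by (simp add: compact_space_product_topology compact_bool)
  then show ?thesis
    by (simp add: euclidean_product_topology compact_space_def)
qed

text \<open>
  Every point has a cylinder inside \<open>S\<close> or inside its complement; by compactness finitely many of these
  cylinders cover the space, and the longest of them bounds the relevant coordinates.
\<close>

lemma clopen_finitely_determined:
  fixes S :: "cantor set"
  assumes "open S" "closed S"
  obtains m where "\<And>x y. x \<in> S \<Longrightarrow> y \<notin> S \<Longrightarrow> \<exists>i<m. x i \<noteq> y i"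
proof -
  have "\<exists>k. cylinder x k \<subseteq> S \<or> cylinder x k \<subseteq> - S" for x
  proof (cases "x \<in> S")
    case True
    then show ?thesis using open_contains_cylinder[OF assms(1)] by metis
  next
    case False
    then show ?thesis using open_contains_cylinder[OF open_Compl[OF assms(2)]] by (metis ComplI)
  qed
  then obtain k where k: "\<And>x. cylinder x (k x) \<subseteq> S \<or> cylinder x (k x) \<subseteq> - S" by metis
  have cover: "UNIV \<subseteq> (\<Union>x. cylinder x (k x))" by (auto simp: cylinder_def)
  obtain F where F: "finite F" "UNIV \<subseteq> (\<Union>x\<in>F. cylinder x (k x))"
    by (rule compactE_image[OF compact_cantor _ cover])
       (auto intro: clopen_cylinder)
  obtain m where m: "\<And>z. z \<in> F \<Longrightarrow> k z \<le> m"
    using finite_nat_set_iff_bounded_le[of "k ` F"] F(1) by auto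
  have "\<exists>i<m. x i \<noteq> y i" if "x \<in> S" "y \<notin> S" for x y
  proof (rule ccontr)
    assume same: "\<not> ?thesis"
    obtain z where z: "z \<in> F" "x \<in> cylinder z (k z)" using F(2) by blast
    then have "y \<in> cylinder z (k z)"
      using same m[OF z(1)] by (auto simp: cylinder_def)
    then show False using z k[of z] that by blast
  qed
  then show ?thesis using that by blast
qed

section \<open>Separators extracted from protocols\<close>

text \<open>
  Exchanging the players turns a separator into its complement, so the step for a node of Bob
  follows from the one for a node of Alice.
\<close>

lemma separates_Compl: "separates (- S) B A \<longleftrightarrow> separates S A B"
  unfolding separates_def by blast

lemma message_edge:
  assumes "protocol P" "v \<in> nodes P" "nlabel P v = Alice a \<or> nlabel P v = Bob a" "n \<in> range a"
  shows "\<exists>w. w \<in> children (nodes P) v \<and> elabel P w = n"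
proof -
  have "\<forall>n\<in>range a. \<exists>!w. w \<in> children (nodes P) v \<and> elabel P w = n"
    using assms(1-3) unfolding protocol_def
    by (elim conjE disjE) (drule (1) bspec, simp only: node_label.case)+
  then show ?thesis using assms(4) by blast
qed

lemma children_subset_nodes: "children T v \<subseteq> T"
  by (auto simp: children_def)

lemma subtree_child_subset: "w \<in> children T v \<Longrightarrow> subtree T w \<subseteq> subtree T v"
  by (auto simp: children_def subtree_def)

lemma child_in_subtree: "w \<in> children T v \<Longrightarrow> w \<in> subtree T v"
  by (auto simp: children_def subtree_def)

lemma subtree_childless:
  assumes T: "wf_tree T" and v: "v \<in> T" and "children T v = {}"
  shows "subtree T v = {v}"
proof -
  have "u = []" if u: "v @ u \<in> T" for u
  proof (cases u)
    case (Cons n u')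
    then have "v @ [n] \<in> T" using wf_tree_prefix[OF T, of "v @ [n]" u'] u by simp
    then show ?thesis using assms(3) by (auto simp: children_def)
  qed
  then show ?thesis using v by (auto simp: subtree_def)
qed

lemma node_rank_finite:
  "wf_tree T \<Longrightarrow> v \<in> T \<Longrightarrow> finite (subtree T v) \<Longrightarrow> node_rank T v = 0"
  by (simp add: node_rank_unfold)

text \<open>
  The supremum that defines the rank is bounded because a node has only countably many children.
\<close>

lemma node_rank_child_less:
  assumes "wf_tree T" "v \<in> T" "infinite (subtree T v)" "w \<in> children T v"
  shows "node_rank T w < node_rank T v"
proof -
  have "bdd_above ((\<lambda>w. succ_omega1 (node_rank T w)) ` children T v)"
    by (intro countable_bdd_above_omega1) simp
  from cSUP_upper[OF assms(4) this]
  have "succ_omega1 (node_rank T w) \<le> node_rank T v"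
    using assms by (simp add: node_rank_unfold[of T v])
  then show ?thesis using less_succ_omega1 by (rule less_le_trans[rotated])
qed

text \<open>
  A node of rank \<open>0\<close> may be the root of a finite subtree of any height; all of it must be absorbed into
  one clopen set.  Finitely many children leave room for finitely many messages only, so all
  unions and intersections in the construction are finite.
\<close>

lemma finite_subtree_clopen_separator:
  assumes P: "protocol P"
  shows "v \<in> nodes P \<Longrightarrow> finite (subtree (nodes P) v) \<Longrightarrow>
    (\<And>x y. x \<in> A \<Longrightarrow> y \<in> B \<Longrightarrow> visits P x y v \<and> x (run P x y) \<noteq> y (run P x y)) \<Longrightarrow>
    \<exists>S. open S \<and> closed S \<and> separates S A B"
proof -
  have "wf (child_rel (nodes P))" using P wf_child_rel by (auto simp: protocol_def)
  then show "v \<in> nodes P \<Longrightarrow> finite (subtree (nodes P) v) \<Longrightarrow>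
    (\<And>x y. x \<in> A \<Longrightarrow> y \<in> B \<Longrightarrow> visits P x y v \<and> x (run P x y) \<noteq> y (run P x y)) \<Longrightarrow>
    \<exists>S. open S \<and> closed S \<and> separates S A B"
  proof (induction v arbitrary: A B rule: wf_induct_rule)
    case (less v)
    have finite_range: "finite (range a)"
      if l: "nlabel P v = Alice a \<or> nlabel P v = Bob a" for a
    proof -
      have "range a \<subseteq> elabel P ` children (nodes P) v"
      proof
        fix n assume "n \<in> range a"
        from message_edge[OF P less.prems(1) l this]
        obtain w where "w \<in> children (nodes P) v" "elabel P w = n" by blast
        then show "n \<in> elabel P ` children (nodes P) v" by (intro image_eqI[of _ _ w]) auto
      qed
      moreover have "finite (children (nodes P) v)"
        by (rule finite_subset[OF _ less.prems(2)]) (auto intro: child_in_subtree)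
      ultimately show ?thesis by (rule finite_subset[OF _ finite_imageI])
    qed
    have IH: "\<exists>S. open S \<and> closed S \<and> separates S A' B'"
      if "w \<in> children (nodes P) v"
        "\<And>x y. x \<in> A' \<Longrightarrow> y \<in> B' \<Longrightarrow> visits P x y w \<and> x (run P x y) \<noteq> y (run P x y)" for w A' B'
    proof (rule less.IH[OF _ _ _ that(2)])
      show "(w, v) \<in> child_rel (nodes P)" using that(1) less.prems(1) by (simp add: child_rel_def)
      show "w \<in> nodes P" using that(1) children_subset_nodes by blast
      show "finite (subtree (nodes P) w)"
        by (rule finite_subset[OF subtree_child_subset[OF that(1)] less.prems(2)])
    qed
    show ?case
    proof (cases "nlabel P v")
      case (Alice a)
      have "\<exists>S. open S \<and> closed S \<and> separates S {x\<in>A. a x = n} B" if n: "n \<in> range a" for n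
      proof -
        obtain w where w: "w \<in> children (nodes P) v" "elabel P w = n"
          using message_edge[OF P less.prems(1) disjI1[OF Alice] n] by blast
        show ?thesis
          using less.prems(3) visits_Alice[OF _ Alice w(1)] w(2) by (intro IH[OF w(1)]) auto
      qed
      then obtain S where S: "\<And>n. n \<in> range a \<Longrightarrow> open (S n) \<and> closed (S n) \<and> separates (S n) {x\<in>A. a x = n} B"
        by metis
      have "separates (\<Union>n\<in>range a. S n) A B"
        using S by (fastforce simp: separates_def)
      then show ?thesis
        using S finite_range[OF disjI1[OF Alice]]
        by (intro exI[of _ "\<Union>n\<in>range a. S n"] conjI open_UN closed_UN) auto
    next
      case (Bob b)
      have "\<exists>S. open S \<and> closed S \<and> separates S A {y\<in>B. b y = n}" if n: "n \<in> range b" for n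
      proof -
        obtain w where w: "w \<in> children (nodes P) v" "elabel P w = n"
          using message_edge[OF P less.prems(1) disjI2[OF Bob] n] by blast
        show ?thesis
          using less.prems(3) visits_Bob[OF _ Bob w(1)] w(2) by (intro IH[OF w(1)]) auto
      qed
      then obtain S where S: "\<And>n. n \<in> range b \<Longrightarrow> open (S n) \<and> closed (S n) \<and> separates (S n) A {y\<in>B. b y = n}"
        by metis
      have "separates (\<Inter>n\<in>range b. S n) A B"
        using S by (fastforce simp: separates_def)
      then show ?thesis
        using S finite_range[OF disjI2[OF Bob]]
        by (intro exI[of _ "\<Inter>n\<in>range b. S n"] conjI open_INT closed_INT) auto
    next
      case (Leaf z)
      have differ: "x z \<noteq> y z" if "x \<in> A" "y \<in> B" for x y
        using less.prems(3)[OF that] run_eqI[OF P _ Leaf] by metis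
      define S where "S = (\<Union>c\<in>(\<lambda>x. x z) ` A. {x::cantor. x z = c})"
      have "open S" unfolding S_def by (intro open_UN ballI clopen_coordinate)
      moreover have "closed S" unfolding S_def by (intro closed_UN ballI clopen_coordinate finite)
      moreover have "separates S A B"
        unfolding S_def separates_def using differ by auto
      ultimately show ?thesis by blast
    qed
  qed
qed

text \<open>
  The step for a node of Alice, whose messages split \<open>A\<close> into pieces.
\<close>

lemma Sigma0_separator_Union:
  assumes "\<And>n::nat. \<exists>S \<beta>. \<beta> < \<alpha> \<and> (Sigma0 \<beta> S \<or> Pi0 \<beta> S) \<and> separates S (A n) B"
  shows "\<exists>S. Sigma0 \<alpha> S \<and> separates S (\<Union>n. A n) B"
proof -
  obtain S \<beta> where S: "\<And>n. \<beta> n < \<alpha> \<and> (Sigma0 (\<beta> n) (S n) \<or> Pi0 (\<beta> n) (S n)) \<and> separates (S n) (A n) B"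
    using assms by metis
  then have "Sigma0 \<alpha> (\<Union>n. S n)" by (intro Sigma0_countable_Union) auto
  moreover have "separates (\<Union>n. S n) (\<Union>n. A n) B" using S by (fastforce simp: separates_def)
  ultimately show ?thesis by blast
qed

lemma Pi0_separator_Union:
  assumes "\<And>n::nat. \<exists>S \<beta>. \<beta> < \<alpha> \<and> (Sigma0 \<beta> S \<or> Pi0 \<beta> S) \<and> separates S A (B n)"
  shows "\<exists>S. Pi0 \<alpha> S \<and> separates S A (\<Union>n. B n)"
proof -
  have "\<exists>S. Sigma0 \<alpha> S \<and> separates S (\<Union>n. B n) A"
    by (rule Sigma0_separator_Union) (metis assms separates_Compl Sigma0_Compl_iff Pi0_Compl_iff)
  then show ?thesis by (metis separates_Compl Pi0_Compl_iff)
qed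

text \<open>
  The sets \<open>A\<close> and \<open>B\<close> vary in the induction: at a node they hold inputs of the two
  players that lead there, and each message shrinks one of them.
\<close>

lemma separator_of_node:
  assumes P: "protocol P"
  shows "v \<in> nodes P \<Longrightarrow>
    (\<And>x y. x \<in> A \<Longrightarrow> y \<in> B \<Longrightarrow> visits P x y v \<and> x (run P x y) \<noteq> y (run P x y)) \<Longrightarrow>
    \<exists>S. (Sigma0 (node_rank (nodes P) v) S \<or> Pi0 (node_rank (nodes P) v) S) \<and> separates S A B"
proof -
  have T: "wf_tree (nodes P)" using P by (simp add: protocol_def)
  show "v \<in> nodes P \<Longrightarrow>
    (\<And>x y. x \<in> A \<Longrightarrow> y \<in> B \<Longrightarrow> visits P x y v \<and> x (run P x y) \<noteq> y (run P x y)) \<Longrightarrow>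
    \<exists>S. (Sigma0 (node_rank (nodes P) v) S \<or> Pi0 (node_rank (nodes P) v) S) \<and> separates S A B"
    using wf_child_rel[OF T]
  proof (induction v arbitrary: A B rule: wf_induct_rule)
    case (less v)
    show ?case
    proof (cases "finite (subtree (nodes P) v)")
      case True
      then show ?thesis
        using finite_subtree_clopen_separator[OF P less.prems(1) True less.prems(2)]
          node_rank_finite[OF T less.prems(1) True] by (metis Sigma0_clopen)
    next
      case False
      have IH: "\<exists>S \<beta>. \<beta> < node_rank (nodes P) v \<and> (Sigma0 \<beta> S \<or> Pi0 \<beta> S) \<and> separates S A' B'"
        if "w \<in> children (nodes P) v"
          "\<And>x y. x \<in> A' \<Longrightarrow> y \<in> B' \<Longrightarrow> visits P x y w \<and> x (run P x y) \<noteq> y (run P x y)" for w A' B'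
      proof -
        have "w \<in> nodes P" using that(1) children_subset_nodes by blast
        moreover have "(w, v) \<in> child_rel (nodes P)"
          using that(1) less.prems(1) by (simp add: child_rel_def)
        ultimately have "\<exists>S. (Sigma0 (node_rank (nodes P) w) S \<or> Pi0 (node_rank (nodes P) w) S) \<and>
            separates S A' B'"
          using that(2) by (intro less.IH)
        then show ?thesis
          using node_rank_child_less[OF T less.prems(1) False that(1)] by blast
      qed
      show ?thesis
      proof (cases "nlabel P v")
        case (Alice a)
        have "\<exists>S \<beta>. \<beta> < node_rank (nodes P) v \<and> (Sigma0 \<beta> S \<or> Pi0 \<beta> S) \<and> separates S {x\<in>A. a x = n} B" for n
        proof -
          \<comment> \<open>A number \<open>n\<close> that Alice never sends gives an empty piece, for which any child will do.\<close>
          obtain w where w: "w \<in> children (nodes P) v" "n \<in> range a \<Longrightarrow> elabel P w = n"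
            using message_edge[OF P less.prems(1) disjI1[OF Alice]] by (metis rangeI)
          show ?thesis
            using less.prems(2) visits_Alice[OF _ Alice w(1)] w(2) by (intro IH[OF w(1)]) auto
        qed
        then have "\<exists>S. Sigma0 (node_rank (nodes P) v) S \<and> separates S (\<Union>n. {x\<in>A. a x = n}) B"
          by (rule Sigma0_separator_Union)
        moreover have "(\<Union>n. {x\<in>A. a x = n}) = A" by auto
        ultimately show ?thesis by auto
      next
        case (Bob b)
        have "\<exists>S \<beta>. \<beta> < node_rank (nodes P) v \<and> (Sigma0 \<beta> S \<or> Pi0 \<beta> S) \<and> separates S A {y\<in>B. b y = n}" for n
        proof -
          \<comment> \<open>A number \<open>n\<close> that Bob never sends gives an empty piece, for which any child will do.\<close>
          obtain w where w: "w \<in> children (nodes P) v" "n \<in> range b \<Longrightarrow> elabel P w = n"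
            using message_edge[OF P less.prems(1) disjI2[OF Bob]] by (metis rangeI)
          show ?thesis
            using less.prems(2) visits_Bob[OF _ Bob w(1)] w(2) by (intro IH[OF w(1)]) auto
        qed
        then have "\<exists>S. Pi0 (node_rank (nodes P) v) S \<and> separates S A (\<Union>n. {y\<in>B. b y = n})"
          by (rule Pi0_separator_Union)
        moreover have "(\<Union>n. {y\<in>B. b y = n}) = B" by auto
        ultimately show ?thesis by auto
      next
        case (Leaf z)
        have "children (nodes P) v = {}"
          using P less.prems(1) Leaf unfolding protocol_def by fastforce
        from subtree_childless[OF T less.prems(1) this] show ?thesis using False by simp
      qed
    qed
  qed
qed

section \<open>Grafting trees and protocols\<close>

text \<open>
  A new root whose \<open>n\<close>-th child carries the tree \<open>T n\<close>.  Restricting \<open>n\<close> to \<open>K\<close> serves the protocols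
  for clopen sets, whose trees have to be finite.
\<close>

definition join_trees :: "nat set \<Rightarrow> (nat \<Rightarrow> nat list set) \<Rightarrow> nat list set" where
  "join_trees K T = insert [] (\<Union>n\<in>K. (#) n ` T n)"

lemma Nil_in_join_trees [simp]: "[] \<in> join_trees K T"
  and Cons_in_join_trees [simp]: "n # v \<in> join_trees K T \<longleftrightarrow> n \<in> K \<and> v \<in> T n"
  by (auto simp: join_trees_def)

lemma children_join_trees_root:
  assumes "\<And>n. n \<in> K \<Longrightarrow> wf_tree (T n)"
  shows "children (join_trees K T) [] = (\<lambda>n. [n]) ` K"
  using assms by (auto simp: children_def wf_tree_def)

lemma children_join_trees_Cons:
  "n \<in> K \<Longrightarrow> children (join_trees K T) (n # v) = (#) n ` children (T n) v"
  by (auto simp: children_def)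

lemma subtree_join_trees_Cons:
  "n \<in> K \<Longrightarrow> subtree (join_trees K T) (n # v) = (#) n ` subtree (T n) v"
  by (auto simp: subtree_def)

lemma wf_join_trees:
  assumes T: "\<And>n. n \<in> K \<Longrightarrow> wf_tree (T n)"
  shows "wf_tree (join_trees K T)"
  unfolding wf_tree_def
proof (intro conjI allI impI)
  fix v n assume "v @ [n] \<in> join_trees K T"
  then show "v \<in> join_trees K T"
    using T by (cases v) (auto simp: wf_tree_def)
next
  show "\<not> (\<exists>f. \<forall>k. map f [0..<k] \<in> join_trees K T)"
  proof
    assume "\<exists>f. \<forall>k. map f [0..<k] \<in> join_trees K T"
    then obtain f where f: "\<And>k. map f [0..<k] \<in> join_trees K T" by blast
    have "f 0 \<in> K \<and> map (\<lambda>i. f (Suc i)) [0..<k] \<in> T (f 0)" for k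
      using f[of "Suc k"] by (simp only: map_upt_Suc Cons_in_join_trees)
    then show False using T[of "f 0"] unfolding wf_tree_def by blast
  qed
qed simp

lemma node_rank_join_trees:
  assumes T: "\<And>n. n \<in> K \<Longrightarrow> wf_tree (T n)" and n: "n \<in> K"
  shows "v \<in> T n \<Longrightarrow> node_rank (join_trees K T) (n # v) = node_rank (T n) v"
  using wf_child_rel[OF T[OF n]]
proof (induction v rule: wf_induct_rule)
  case (less v)
  have "(SUP w\<in>children (join_trees K T) (n # v). succ_omega1 (node_rank (join_trees K T) w))
      = (SUP w\<in>children (T n) v. succ_omega1 (node_rank (T n) w))"
    unfolding children_join_trees_Cons[OF n] image_image
  proof (rule SUP_cong[OF refl])
    fix w assume w: "w \<in> children (T n) v"
    then have "w \<in> T n" using children_subset_nodes by blast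
    then show "succ_omega1 (node_rank (join_trees K T) (n # w)) = succ_omega1 (node_rank (T n) w)"
      using less.IH[of w] w less.prems by (simp add: child_rel_def)
  qed
  moreover have "finite (subtree (join_trees K T) (n # v)) \<longleftrightarrow> finite (subtree (T n) v)"
    unfolding subtree_join_trees_Cons[OF n] by (rule finite_image_iff) simp
  ultimately show ?case
    using less.prems n T wf_join_trees[of K T, OF T] by (simp add: node_rank_unfold)
qed

text \<open>
  The bound is not \<open>Sup\<close> of the ranks plus one but any strict bound of them; this fits the
  definition of the Borel classes, and it includes the case of a finite tree, of rank \<open>0\<close>.
\<close>

lemma essential_rank_join_trees_le:
  assumes T: "\<And>n. n \<in> K \<Longrightarrow> wf_tree (T n)"
    and less: "\<And>n. n \<in> K \<Longrightarrow> essential_rank (T n) < \<alpha>"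
  shows "essential_rank (join_trees K T) \<le> \<alpha>"
proof -
  have wf: "wf_tree (join_trees K T)" by (rule wf_join_trees[OF T])
  show ?thesis
  proof (cases "finite (join_trees K T)")
    case True
    then have "finite (subtree (join_trees K T) [])" by (simp add: subtree_def)
    then show ?thesis by (simp add: essential_rank_def node_rank_finite[OF wf])
  next
    case False
    have inf: "infinite (subtree (join_trees K T) [])" using False by (simp add: subtree_def)
    have "K \<noteq> {}" using False by (auto simp: join_trees_def)
    have "succ_omega1 (node_rank (join_trees K T) [n]) \<le> \<alpha>" if "n \<in> K" for n
      using less[OF that] T[OF that] node_rank_join_trees[of K T n "[]", OF T that]
      by (simp add: succ_omega1_le essential_rank_def wf_tree_def)
    then have "(SUP w\<in>children (join_trees K T) []. succ_omega1 (node_rank (join_trees K T) w)) \<le> \<alpha>"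
      using \<open>K \<noteq> {}\<close> by (intro cSUP_least) (auto simp: children_join_trees_root[OF T])
    then show ?thesis
      using inf by (simp add: essential_rank_def node_rank_unfold[OF wf])
  qed
qed

definition leaf :: "'z \<Rightarrow> 'z proto" where
  "leaf z = \<lparr>nodes = {[]}, nlabel = (\<lambda>_. Leaf z), elabel = (\<lambda>_. 0)\<rparr>"

definition graft :: "'z node_label \<Rightarrow> nat set \<Rightarrow> (nat \<Rightarrow> 'z proto) \<Rightarrow> 'z proto" where
  "graft L K Q = \<lparr>nodes = join_trees K (\<lambda>n. nodes (Q n)),
     nlabel = (\<lambda>v. case v of [] \<Rightarrow> L | n # u \<Rightarrow> nlabel (Q n) u),
     elabel = (\<lambda>v. case v of [] \<Rightarrow> 0 | n # u \<Rightarrow> if u = [] then n else elabel (Q n) u)\<rparr>"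

text \<open>
  One function for both kinds of speaker, so that grafting is treated once and not separately for
  Alice and Bob.  The value at a leaf is arbitrary.
\<close>

fun message :: "'z node_label \<Rightarrow> cantor \<Rightarrow> cantor \<Rightarrow> nat" where
  "message (Alice a) x y = a x"
| "message (Bob b) x y = b y"
| "message (Leaf z) x y = 0"

lemma protocol_leaf: "protocol (leaf z)"
  by (auto simp: protocol_def leaf_def wf_tree_def children_def dest: spec[of _ 1])

lemma run_leaf [simp]: "run (leaf (z :: 'z::countable)) x y = z"
  by (rule run_eqI[OF protocol_leaf visits_root]) (simp add: leaf_def)

lemma ex1_image_Cons: "(\<exists>!w. w \<in> (#) k ` C \<and> P w) \<longleftrightarrow> (\<exists>!w. w \<in> C \<and> P (k # w))"
  unfolding Ex1_def by auto

lemma protocol_graft: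
  assumes Q: "\<And>n. n \<in> K \<Longrightarrow> protocol (Q n)"
    and L: "\<And>x y. message L x y \<in> K" "\<And>z. L \<noteq> Leaf z"
  shows "protocol (graft L K Q)"
  unfolding protocol_def
proof (intro conjI ballI)
  have T: "wf_tree (nodes (Q n))" if "n \<in> K" for n using Q[OF that] by (simp add: protocol_def)
  then show "wf_tree (nodes (graft L K Q))" by (simp add: graft_def wf_join_trees)
  fix v assume v: "v \<in> nodes (graft L K Q)"
  show "case nlabel (graft L K Q) v of
        Alice a \<Rightarrow> \<forall>n\<in>range a. \<exists>!w. w \<in> children (nodes (graft L K Q)) v \<and> elabel (graft L K Q) w = n
      | Bob b \<Rightarrow> \<forall>n\<in>range b. \<exists>!w. w \<in> children (nodes (graft L K Q)) v \<and> elabel (graft L K Q) w = n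
      | Leaf z \<Rightarrow> children (nodes (graft L K Q)) v = {}"
  proof (cases v)
    case Nil
    have "\<exists>!w. w \<in> children (nodes (graft L K Q)) [] \<and> elabel (graft L K Q) w = n" if "n \<in> K" for n
      using that by (auto simp: graft_def children_join_trees_root[OF T])
    then show ?thesis
      using Nil L by (cases L) (auto simp: graft_def)
  next
    case (Cons k u)
    then have k: "k \<in> K" and u: "u \<in> nodes (Q k)" using v by (auto simp: graft_def)
    have ch: "children (nodes (graft L K Q)) v = (#) k ` children (nodes (Q k)) u"
      using Cons k by (simp add: graft_def children_join_trees_Cons)
    have el: "elabel (graft L K Q) (k # w) = elabel (Q k) w" if "w \<in> children (nodes (Q k)) u" for w
      using that by (auto simp: graft_def children_def)
    have ex1: "(\<exists>!w. w \<in> children (nodes (graft L K Q)) v \<and> elabel (graft L K Q) w = n)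
        \<longleftrightarrow> (\<exists>!w. w \<in> children (nodes (Q k)) u \<and> elabel (Q k) w = n)" for n
      unfolding ch ex1_image_Cons using el by (simp cong: conj_cong)
    have "nlabel (graft L K Q) v = nlabel (Q k) u" using Cons by (simp add: graft_def)
    moreover have "case nlabel (Q k) u of
        Alice a \<Rightarrow> \<forall>n\<in>range a. \<exists>!w. w \<in> children (nodes (Q k)) u \<and> elabel (Q k) w = n
      | Bob b \<Rightarrow> \<forall>n\<in>range b. \<exists>!w. w \<in> children (nodes (Q k)) u \<and> elabel (Q k) w = n
      | Leaf z \<Rightarrow> children (nodes (Q k)) u = {}"
      using Q[OF k] u unfolding protocol_def by blast
    ultimately show ?thesis by (cases "nlabel (Q k) u") (simp_all only: node_label.case ex1, simp add: ch)
  qed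
qed

text \<open>
  After the first message \<open>n\<close>, the run of the grafted protocol is the run of \<open>Q n\<close> shifted by one level.
\<close>

lemma visits_graft:
  assumes Q: "\<And>n. n \<in> K \<Longrightarrow> protocol (Q n)" and L: "message L x y \<in> K" "\<And>z. L \<noteq> Leaf z"
  shows "visits (Q (message L x y)) x y v \<Longrightarrow> visits (graft L K Q) x y (message L x y # v)"
proof (induction rule: visits.induct)
  case visits_root
  have "[message L x y] \<in> children (nodes (graft L K Q)) []"
    using Q[OF L(1)] L(1) by (auto simp: graft_def children_def protocol_def wf_tree_def)
  then show ?case
    using L(2) by (cases L)
      (auto intro: visits.visits_Alice[OF visits.visits_root] visits.visits_Bob[OF visits.visits_root]
         simp: graft_def)
next
  case (visits_Alice v a w)
  then have "w \<noteq> []" by (auto simp: children_def)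
  with visits_Alice L(1) show ?case
    by (intro visits.visits_Alice[OF visits_Alice.IH, of a])
       (auto simp: graft_def children_join_trees_Cons)
next
  case (visits_Bob v b w)
  then have "w \<noteq> []" by (auto simp: children_def)
  with visits_Bob L(1) show ?case
    by (intro visits.visits_Bob[OF visits_Bob.IH, of b])
       (auto simp: graft_def children_join_trees_Cons)
qed

lemma run_graft:
  assumes Q: "\<And>n. n \<in> K \<Longrightarrow> protocol (Q n)"
    and L: "\<And>x y. message L x y \<in> K" "\<And>z. L \<noteq> Leaf z"
  shows "run (graft L K Q) x y = run (Q (message L x y)) x y"
proof -
  let ?n = "message L x y"
  obtain v z where v: "visits (Q ?n) x y v" "nlabel (Q ?n) v = Leaf z"
    using visits_leaf_exists[OF Q[OF L(1)] visits_root] by blast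
  have "visits (graft L K Q) x y (?n # v)"
    by (rule visits_graft[where K = K and Q = Q, OF Q L v(1)])
  moreover have "nlabel (graft L K Q) (?n # v) = Leaf z" using v(2) by (simp add: graft_def)
  moreover have "protocol (graft L K Q)" using Q L by (rule protocol_graft)
  ultimately have "run (graft L K Q) x y = z" by (metis run_eqI)
  moreover have "run (Q ?n) x y = z" by (rule run_eqI[OF Q[OF L(1)] v])
  ultimately show ?thesis by simp
qed

lemma cost_graft_le:
  assumes Q: "\<And>n. n \<in> K \<Longrightarrow> protocol (Q n) \<and> cost (Q n) < \<alpha>"
  shows "cost (graft L K Q) \<le> \<alpha>"
proof -
  have "essential_rank (join_trees K (\<lambda>n. nodes (Q n))) \<le> \<alpha>"
    using Q by (intro essential_rank_join_trees_le) (auto simp: protocol_def cost_def)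
  then show ?thesis by (simp add: cost_def graft_def)
qed

lemma cost_finite: "protocol P \<Longrightarrow> finite (nodes P) \<Longrightarrow> cost P = 0"
  unfolding cost_def essential_rank_def
  by (rule node_rank_finite) (auto simp: protocol_def wf_tree_def subtree_def)

lemma finite_graft: "finite K \<Longrightarrow> (\<And>n. n \<in> K \<Longrightarrow> finite (nodes (Q n))) \<Longrightarrow> finite (nodes (graft L K Q))"
  by (simp add: graft_def join_trees_def)

section \<open>Protocols built from separators\<close>

text \<open>
  Alice sends her first \<open>m\<close> bits, encoded as one number, and Bob answers with the first index at which his
  input differs from them.  As \<open>m\<close> is fixed, both messages have finite range.
\<close>

lemma solves_KW_clopen:
  assumes "open S" "closed S"
  shows "\<exists>P. solves_KW P S (- S) \<and> cost P = 0"
proof -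
  obtain m where m: "\<And>x y. x \<in> S \<Longrightarrow> y \<notin> S \<Longrightarrow> \<exists>i<m. x i \<noteq> y i"
    using clopen_finitely_determined[OF assms] by metis
  define prefix where "prefix x = to_nat (map x [0..<m])" for x :: cantor
  define bit where "bit c i = (from_nat c ! i :: bool)" for c i
  have bit: "bit (prefix x) i = x i" if "i < m" for x i
    using that by (simp add: bit_def prefix_def)
  \<comment> \<open>The value \<open>0\<close> is a default for inputs that agree with the prefix on all \<open>m\<close> bits.  If \<open>m = 0\<close>
    it is the only value, which is why the range below is bounded by \<open>m\<close> and not by \<open>m - 1\<close>.\<close>
  define b where "b c y = (if \<exists>i<m. bit c i \<noteq> y i then LEAST i. i < m \<and> bit c i \<noteq> y i else 0)"
    for c and y :: cantor
  have b: "b c y < m \<and> bit c (b c y) \<noteq> y (b c y)" if "\<exists>i<m. bit c i \<noteq> y i" for c y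
    using LeastI_ex[OF that] that by (simp add: b_def)
  have b_range: "b c y \<in> {..m}" for c y
    using b[of c y] by (cases "\<exists>i<m. bit c i \<noteq> y i") (auto simp: b_def)
  define Q where "Q c = graft (Bob (b c)) {..m} leaf" for c
  have Q: "protocol (Q c)" for c
    unfolding Q_def by (intro protocol_graft protocol_leaf) (use b_range in auto)
  have run_Q: "run (Q c) x y = b c y" for c x y
    unfolding Q_def by (subst run_graft) (use b_range protocol_leaf in auto)
  define P where "P = graft (Alice prefix) (range prefix) Q"
  have P: "protocol P" unfolding P_def by (intro protocol_graft Q) auto
  have run_P: "run P x y = b (prefix x) y" for x y
    unfolding P_def by (subst run_graft) (use Q run_Q in auto)
  have "range prefix \<subseteq> to_nat ` {l::bool list. set l \<subseteq> UNIV \<and> length l = m}"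
    unfolding prefix_def by auto
  then have "finite (range prefix)"
    by (rule finite_subset) (intro finite_imageI finite_lists_length_eq finite)
  then have "finite (nodes P)"
    unfolding P_def Q_def by (intro finite_graft) (auto simp: leaf_def)
  then have "cost P = 0" by (rule cost_finite[OF P])
  moreover have "solves_KW P S (- S)"
    unfolding solves_KW_def run_P
  proof (intro conjI ballI P)
    fix x y assume "x \<in> S" "y \<in> - S"
    then have "\<exists>i<m. bit (prefix x) i \<noteq> y i" using m[of x y] bit by auto
    from b[OF this] show "x (b (prefix x) y) \<noteq> y (b (prefix x) y)" using bit by metis
  qed
  ultimately show ?thesis by blast
qed

text \<open>
  The inductive definition of the classes is followed literally: a union becomes a first message of
  Alice, an intersection a first message of Bob.
\<close>

lemma solves_KW_hierarchy:
  "Sigma0 \<alpha> S \<Longrightarrow> \<exists>P. solves_KW P S (- S) \<and> cost P \<le> \<alpha>"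
  "Pi0 \<alpha> S \<Longrightarrow> \<exists>P. solves_KW P S (- S) \<and> cost P \<le> \<alpha>"
proof (induction rule: Sigma0_Pi0.inducts)
  case (Sigma0_Union \<alpha> \<beta> S)
  then obtain Q where Q: "\<And>n. solves_KW (Q n) (S n) (- S n) \<and> cost (Q n) \<le> \<beta> n" by metis
  define L :: "nat node_label" where "L = Alice (\<lambda>x. LEAST n. x \<in> S n)"
  have prot: "protocol (Q n)" for n using Q[of n] by (simp add: solves_KW_def)
  have "cost (Q n) < \<alpha>" for n using Q[of n] Sigma0_Union.hyps(2)[of n] by (meson le_less_trans)
  then have "cost (graft L UNIV Q) \<le> \<alpha>" using prot by (intro cost_graft_le) simp
  moreover have "solves_KW (graft L UNIV Q) (\<Union>n. S n) (- (\<Union>n. S n))"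
    unfolding solves_KW_def
  proof (intro conjI ballI)
    show "protocol (graft L UNIV Q)" by (rule protocol_graft) (auto simp: prot L_def)
    fix x y assume x: "x \<in> (\<Union>n. S n)" and y: "y \<in> - (\<Union>n. S n)"
    let ?n = "LEAST n. x \<in> S n"
    have "x \<in> S ?n" using x by (auto intro: LeastI)
    moreover have "run (graft L UNIV Q) x y = run (Q ?n) x y"
      by (subst run_graft) (auto simp: prot L_def)
    ultimately show "x (run (graft L UNIV Q) x y) \<noteq> y (run (graft L UNIV Q) x y)"
      using Q[of ?n] y by (auto simp: solves_KW_def)
  qed
  ultimately show ?case by blast
next
  case (Pi0_Inter \<alpha> \<beta> S)
  then obtain Q where Q: "\<And>n. solves_KW (Q n) (S n) (- S n) \<and> cost (Q n) \<le> \<beta> n" by metis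
  define L :: "nat node_label" where "L = Bob (\<lambda>y. LEAST n. y \<notin> S n)"
  have prot: "protocol (Q n)" for n using Q[of n] by (simp add: solves_KW_def)
  have "cost (Q n) < \<alpha>" for n using Q[of n] Pi0_Inter.hyps(2)[of n] by (meson le_less_trans)
  then have "cost (graft L UNIV Q) \<le> \<alpha>" using prot by (intro cost_graft_le) simp
  moreover have "solves_KW (graft L UNIV Q) (\<Inter>n. S n) (- (\<Inter>n. S n))"
    unfolding solves_KW_def
  proof (intro conjI ballI)
    show "protocol (graft L UNIV Q)" by (rule protocol_graft) (auto simp: prot L_def)
    fix x y assume x: "x \<in> (\<Inter>n. S n)" and y: "y \<in> - (\<Inter>n. S n)"
    let ?n = "LEAST n. y \<notin> S n"
    have "\<exists>n. y \<notin> S n" using y by simp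
    then have "y \<notin> S ?n" by (rule LeastI_ex)
    moreover have "run (graft L UNIV Q) x y = run (Q ?n) x y"
      by (subst run_graft) (auto simp: prot L_def)
    ultimately show "x (run (graft L UNIV Q) x y) \<noteq> y (run (graft L UNIV Q) x y)"
      using Q[of ?n] x by (auto simp: solves_KW_def)
  qed
  ultimately show ?case by blast
qed (use solves_KW_clopen in fastforce)+

lemma solves_KW_separator:
  assumes "S \<in> sets borel" "separates S A B"
  shows "\<exists>P. solves_KW P A B \<and> cost P \<le> borel_rank S"
proof -
  have "\<exists>P. solves_KW P S (- S) \<and> cost P \<le> borel_rank S"
    using borel_rank_in_hierarchy[OF assms(1)]
  proof
    assume "Sigma0 (borel_rank S) S"
    then show ?thesis by (rule solves_KW_hierarchy)
  next
    assume "Pi0 (borel_rank S) S"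
    then show ?thesis by (rule solves_KW_hierarchy)
  qed
  then obtain P where P: "solves_KW P S (- S)" "cost P \<le> borel_rank S" by blast
  have "A \<subseteq> S" "B \<subseteq> - S" using assms(2) by (auto simp: separates_def)
  then have "solves_KW P A B" using P(1) unfolding solves_KW_def by blast
  then show ?thesis using P(2) by blast
qed

text \<open>
  The whole protocol is the case of the root, which every run visits.
\<close>

lemma separator_of_protocol:
  assumes "solves_KW P A B"
  shows "\<exists>S\<in>sets borel. separates S A B \<and> borel_rank S \<le> cost P"
proof -
  have P: "protocol P" using assms by (simp add: solves_KW_def)
  then have root: "[] \<in> nodes P" by (simp add: protocol_def wf_tree_def)
  have "visits P x y [] \<and> x (run P x y) \<noteq> y (run P x y)" if "x \<in> A" "y \<in> B" for x y
    using assms that visits_root by (simp add: solves_KW_def)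
  then obtain S where S: "Sigma0 (cost P) S \<or> Pi0 (cost P) S" and sep: "separates S A B"
    using separator_of_node[OF P root, of A B] unfolding cost_def essential_rank_def by metis
  from S have "borel_rank S \<le> cost P" unfolding borel_rank_def by (rule Least_le)
  moreover from S have "S \<in> sets borel"
    using Sigma0_Pi0_borel[of "cost P" S] by (elim disjE)
  ultimately show ?thesis using sep by blast
qed

lemma separation_rank_eq_D_KW:
  assumes "\<exists>S\<in>sets borel. separates S A B"
  shows "separation_rank A B = D_KW A B"
proof (rule antisym)
  have "\<exists>\<alpha> P. solves_KW P A B \<and> cost P = \<alpha>" using assms solves_KW_separator by blast
  then have "\<exists>P. solves_KW P A B \<and> cost P = D_KW A B"
    unfolding D_KW_def by (rule LeastI_ex)
  then obtain S where "S \<in> sets borel" "separates S A B" "borel_rank S \<le> D_KW A B"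
    using separator_of_protocol by metis
  then show "separation_rank A B \<le> D_KW A B"
    unfolding separation_rank_def by (blast intro: Least_le order_trans)
next
  have "\<exists>\<alpha>. \<exists>S\<in>sets borel. separates S A B \<and> borel_rank S = \<alpha>" using assms by blast
  then have "\<exists>S\<in>sets borel. separates S A B \<and> borel_rank S = separation_rank A B"
    unfolding separation_rank_def by (rule LeastI_ex)
  then obtain P where "solves_KW P A B" "cost P \<le> separation_rank A B"
    using solves_KW_separator by metis
  then show "D_KW A B \<le> separation_rank A B"
    unfolding D_KW_def by (blast intro: Least_le order_trans)
qed

lemma separates_complement_iff: "separates S B (- B) \<longleftrightarrow> S = B"
  unfolding separates_def by blast

lemma separation_rank_complement:
  "B \<in> sets borel \<Longrightarrow> separation_rank B (- B) = borel_rank B"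
  unfolding separation_rank_def by (rule Least_equality) (auto simp: separates_complement_iff)

theorem corollary5p10:
  shows "(\<forall>A B :: cantor set. (\<exists>S\<in>sets borel. separates S A B) \<longrightarrow>
            (\<exists>P. solves_KW P A B) \<and> separation_rank A B = D_KW A B) \<and>
         (\<forall>B :: cantor set. B \<in> sets borel \<longrightarrow>
            (\<exists>P. solves_KW P B (- B)) \<and> borel_rank B = D_KW B (- B))"
proof (intro conjI allI impI)
  fix A B :: "cantor set"
  assume AB: "\<exists>S\<in>sets borel. separates S A B"
  then show "\<exists>P. solves_KW P A B" using solves_KW_separator by blast
  show "separation_rank A B = D_KW A B" by (rule separation_rank_eq_D_KW[OF AB])
next
  fix B :: "cantor set"
  assume B: "B \<in> sets borel"
  then have sep: "\<exists>S\<in>sets borel. separates S B (- B)" by (auto simp: separates_complement_iff)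
  then show "\<exists>P. solves_KW P B (- B)" using solves_KW_separator by blast
  show "borel_rank B = D_KW B (- B)"
    using separation_rank_complement[OF B] separation_rank_eq_D_KW[OF sep] by simp
qed

end
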